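(* Let $X\in\mathbb{R}^{n\times p}$ and $y\in\mathbb{R}^n$ be standardized, i.e. $\sum_{i=1}^ny_i=0$, $\sum_{i=1}^nx_{ij}=0$ and $\frac1n\sum_{i=1}^nx_{ij}^2=1$ for all $j$. Let $r_{\lambda,\gamma}$ be either the MCP penalty with $\gamma>1$ or the SCAD penalty with $\gamma>2$ (defined in the context). Let $\{\beta^k\}\subset\mathbb{R}^p$ be the sequence generated either by the cyclic updates, for $j=1,\dots,p$ in each cycle $k$, $$\beta_j^{k+1}=\arg\min_{\beta_j}\ \frac1{2n}\|x_j\|^2(\beta_j-\beta_j^k)^2+\frac1nx_j^\top\big(X(\beta_{<j}^{k+1},\beta_{\ge j}^k)-y\big)\beta_j+r_{\lambda,\gamma}(\beta_j),$$ or by the following updates with shuffling of coordinates, for $j=1,\dots,p$ in each cycle $k$, $$\beta_{\pi_j^k}^{k+1}=\arg\min_{\beta_{\pi_j^k}}\ \frac1{2n}\|x_{\pi_j^k}\|^2(\beta_{\pi_j^k}-\beta_{\pi_j^k}^k)^2+\frac1nx_{\pi_j^k}^\top\big(X(\beta_{\pi_{<j}^k}^{k+1},\beta_{\pi_{\ge j}^k}^k)-y\big)\beta_{\pi_j^k}+r_{\lambda,\gamma}(\beta_{\pi_j^k}),$$ where $(\pi_1^k,\dots,\pi_p^k)$ is any permutation of $(1,\dots,p)$. If $\{\beta^k\}$ has a finite limit point, then $\beta^k$ converges to a coordinate-wise minimizer of $$\min_\beta\ \frac1{2n}\|X\beta-y\|^2+\sum_{j=1}^pr_{\lambda,\ga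mma}(\beta_j).$$
   Context: $x_j$ is the $j$-th column of $X$ and $\|\cdot\|$ is the Euclidean norm. $(\beta_{<j}^{k+1},\beta_{\ge j}^k)$ is the vector whose coordinates with index $<j$ are taken from $\beta^{k+1}$ and those with index $\ge j$ from $\beta^k$. Likewise $(\beta_{\pi_{<j}^k}^{k+1},\beta_{\pi_{\ge j}^k}^k)$ is the vector whose coordinates $\pi_1^k,\dots,\pi_{j-1}^k$ are taken from $\beta^{k+1}$ and whose coordinates $\pi_j^k,\dots,\pi_p^k$ are taken from $\beta^k$. The permutation may change from cycle to cycle. The starting point is arbitrary. MCP penalty ($\lambda\ge0$): $r_{\lambda,\gamma}(\theta)=\lambda|\theta|-\frac{\theta^2}{2\gamma}$ if $|\theta|\le\gamma\lambda$, and $r_{\lambda,\gamma}(\theta)=\frac12\gamma\lambda^2$ if $|\theta|>\gamma\lambda$. SCAD penalty ($\lambda\ge0$): $r_{\lambda,\gamma}(\theta)=\lambda|\theta|$ if $|\theta|\le\lambda$; $r_{\lambda,\gamma}(\theta)=\frac{2\gamma\lambda|\theta|-(\theta^2+\lambda^2)}{2(\gamma-1)}$ if $\lambda<|\theta|\le\gamma\lambda$; $r_{\lambda,\gamma}(\theta)=\frac{\lambda^2(\gamma^2-1)}{2(\gamma-1)}$ if $|\theta|>\gamma\lambda$. A coordinate-wise minimizer of a function $G:\mathbb{R}^p\to\mathbb{R}$ is a point $\beta$ such that, for each $j$, $\beta_j$ minimizes $G$ with respect to its $j$-th coordinate when all the other coordinates of $\beta$ are fixed. *)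

theory Defs
  imports "HOL-Analysis.Analysis"
begin

definition mcp :: "real \<Rightarrow> real \<Rightarrow> real \<Rightarrow> real" where
  "mcp lam \<gamma> \<theta> =
     (if \<bar>\<theta>\<bar> \<le> \<gamma> * lam then lam * \<bar>\<theta>\<bar> - \<theta>\<^sup>2 / (2 * \<gamma>)
      else 1 / 2 * \<gamma> * lam\<^sup>2)"

definition scad :: "real \<Rightarrow> real \<Rightarrow> real \<Rightarrow> real" where
  "scad lam \<gamma> \<theta> =
     (if \<bar>\<theta>\<bar> \<le> lam then lam * \<bar>\<theta>\<bar>
      else if \<bar>\<theta>\<bar> \<le> \<gamma> * lam
        then (2 * \<gamma> * lam * \<bar>\<theta>\<bar> - (\<theta>\<^sup>2 + lam\<^sup>2)) / (2 * (\<gamma> - 1))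
      else lam\<^sup>2 * (\<gamma>\<^sup>2 - 1) / (2 * (\<gamma> - 1)))"

definition standardized :: "real^'p^'n \<Rightarrow> real^'n \<Rightarrow> bool" where
  "standardized X y \<longleftrightarrow>
     (\<Sum>i\<in>UNIV. y $ i) = 0 \<and>
     (\<forall>j. (\<Sum>i\<in>UNIV. X $ i $ j) = 0) \<and>
     (\<forall>j. 1 / real CARD('n) * (\<Sum>i\<in>UNIV. (X $ i $ j)\<^sup>2) = 1)"

definition penalized_ls :: "real^'p^'n \<Rightarrow> real^'n \<Rightarrow> (real \<Rightarrow> real) \<Rightarrow> real^'p \<Rightarrow> real" where
  "penalized_ls X y r b =
     1 / (2 * real CARD('n)) * (norm (X *v b - y))\<^sup>2 + (\<Sum>j\<in>UNIV. r (b $ j))"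

definition coordinatewise_minimizer :: "(real^'p \<Rightarrow> real) \<Rightarrow> real^'p \<Rightarrow> bool" where
  "coordinatewise_minimizer G b \<longleftrightarrow>
     (\<forall>j. is_arg_min (\<lambda>t. G (\<chi> i. if i = j then t else b $ i)) (\<lambda>_. True) (b $ j))"

(* The function of the single real variable t minimized in the update of coordinate j,
   where b is the iterate at the start of the cycle and z the partially updated vector. *)
definition cd_objective ::
    "real^'p^'n \<Rightarrow> real^'n \<Rightarrow> (real \<Rightarrow> real) \<Rightarrow> real^'p \<Rightarrow> real^'p \<Rightarrow> 'p \<Rightarrow> real \<Rightarrow> real" where
  "cd_objective X y r b z j t =
     1 / (2 * real CARD('n)) * (norm (column j X))\<^sup>2 * (t - b $ j)\<^sup>2
     + 1 / real CARD('n) * (column j X \<bullet> (X *v z - y)) * t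
     + r t"

(* The index type 'p, with its linear order, plays the role of 1, ..., p. *)
definition cyclic_updates ::
    "real^'p::{finite,linorder}^'n \<Rightarrow> real^'n \<Rightarrow> (real \<Rightarrow> real) \<Rightarrow> (nat \<Rightarrow> real^'p::{finite,linorder}) \<Rightarrow> bool" where
  "cyclic_updates X y r \<beta> \<longleftrightarrow>
     (\<forall>k j. is_arg_min
        (cd_objective X y r (\<beta> k) (\<chi> i. if i < j then \<beta> (Suc k) $ i else \<beta> k $ i) j)
        (\<lambda>_. True) (\<beta> (Suc k) $ j))"

(* \<pi> k j is the coordinate that is updated at position j of cycle k. *)
definition shuffled_updates ::
    "real^'p::{finite,linorder}^'n \<Rightarrow> real^'n \<Rightarrow> (real \<Rightarrow> real) \<Rightarrow> (nat \<Rightarrow> 'p \<Rightarrow> 'p)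
       \<Rightarrow> (nat \<Rightarrow> real^'p::{finite,linorder}) \<Rightarrow> bool" where
  "shuffled_updates X y r \<pi> \<beta> \<longleftrightarrow>
     (\<forall>k j. is_arg_min
        (cd_objective X y r (\<beta> k)
          (\<chi> i. if i \<in> \<pi> k ` {..<j} then \<beta> (Suc k) $ i else \<beta> k $ i) (\<pi> k j))
        (\<lambda>_. True) (\<beta> (Suc k) $ \<pi> k j))"

end

theory Submission
  imports Defs
begin

text \<open>Standardization gives every coordinate subproblem the curvature of \<open>t\<^sup>2 / 2\<close>, which exceeds
  the concavity of the penalty, so each update decreases the objective \<open>F\<close> at least quadratically in
  the step length.  Let \<open>l\<close> be a limit point and \<open>e\<^sub>k\<close> the excess \<open>F (\<beta> k) - F l\<close>; it decreases to
  zero.  Since the penalty is piecewise quadratic, near \<open>l\<close> the excess is bounded by a multiple of the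
  squared gradient, and the gradient at \<open>\<beta> (k + 1)\<close> is bounded by a multiple of the length of step
  \<open>k\<close>.  Together with the sufficient decrease, step \<open>k\<close> has length at most \<open>M (\<surd>e\<^sub>k - \<surd>e\<^sub>k\<^sub>+\<^sub>1)\<close>.
  Hence \<open>\<parallel>\<beta> k - l\<parallel> + M \<surd>e\<^sub>k\<close> cannot increase once it is small, and it is small along a subsequence.
  The minimality of each update passes to the limit.\<close>

section \<open>Descent sequences and convexity\<close>

text \<open>By symmetry the form at \<open>x\<close> depends only on \<open>A x\<close>: with a
  linear right inverse \<open>G\<close> of \<open>A\<close> on its range it equals
  \<open>A x \<bullet> G (A x)\<close>, and \<open>G\<close> is bounded. Singular and indefinite
  \<open>A\<close> are covered; this is the gradient inequality for a purely quadratic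
  function.\<close>

lemma symmetric_form_le_norm_square:
  fixes A :: "'a::euclidean_space \<Rightarrow> 'a"
  assumes "linear A" and sym: "\<And>x y. x \<bullet> A y = A x \<bullet> y"
  shows "\<exists>C. \<forall>x. x \<bullet> A x \<le> C * (norm (A x))\<^sup>2"
proof -
  obtain G where G: "range G \<subseteq> UNIV" "linear G" "\<forall>v\<in>range A. A (G v) = v"
    using linear_exists_right_inverse_on[OF \<open>linear A\<close> subspace_UNIV] by blast
  obtain B where B: "\<And>x. norm (G x) \<le> B * norm x"
    using linear_bounded[OF G(2)] by blast
  have "x \<bullet> A x \<le> B * (norm (A x))\<^sup>2" for x
  proof -
    have "x \<bullet> A x = x \<bullet> A (G (A x))" using G(3) by simp
    also have "\<dots> = A x \<bullet> G (A x)" by (rule sym)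
    also have "\<dots> \<le> norm (A x) * norm (G (A x))" by (rule norm_cauchy_schwarz)
    also have "\<dots> \<le> norm (A x) * (B * norm (A x))" by (intro mult_left_mono B) simp
    finally show ?thesis by (simp add: power2_eq_square mult_ac)
  qed
  then show ?thesis by blast
qed

text \<open>\<open>u\<close> and \<open>w\<close> stand for the square roots of two successive
  excesses. \<open>M\<close> is so large that \<open>M\<^sup>2\<close> times the decrease
  \<open>a * \<delta>\<^sup>2\<close> absorbs the terms
  \<open>2 * M * w * \<delta> + \<delta>\<^sup>2\<close> of the square of
  \<open>M * w + \<delta>\<close>; hence this sum is at most \<open>M * u\<close>.\<close>

lemma step_le_sqrt_diff:
  fixes a \<kappa> u w \<delta> M :: real
  assumes "a > 0" "\<kappa> \<ge> 0" "M = (2 * \<kappa> + 1) / a + 1"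
    and "\<delta> \<ge> 0" "w \<ge> 0" "u \<ge> 0" "a * \<delta>\<^sup>2 \<le> u\<^sup>2 - w\<^sup>2" "w \<le> \<kappa> * \<delta>"
  shows "\<delta> \<le> M * (u - w)"
proof -
  have M: "M \<ge> 1" using assms by simp
  have "2 * \<kappa> + 1 \<le> a * M" using assms by (simp add: field_simps)
  then have aM: "(2 * \<kappa> + 1) * M \<le> a * M\<^sup>2"
    using M by (simp add: power2_eq_square mult_right_mono flip: mult.assoc)
  have "(M * w + \<delta>)\<^sup>2 = M\<^sup>2 * w\<^sup>2 + 2 * M * w * \<delta> + \<delta>\<^sup>2" by algebra
  also have "\<dots> \<le> M\<^sup>2 * w\<^sup>2 + 2 * M * (\<kappa> * \<delta>) * \<delta> + M * \<delta>\<^sup>2"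
    using assms M mult_right_mono[OF M, of "\<delta>\<^sup>2"]
    by (intro add_mono mult_right_mono mult_left_mono) simp_all
  also have "\<dots> = M\<^sup>2 * w\<^sup>2 + ((2 * \<kappa> + 1) * M) * \<delta>\<^sup>2" by algebra
  also have "\<dots> \<le> M\<^sup>2 * w\<^sup>2 + (a * M\<^sup>2) * \<delta>\<^sup>2"
    using aM by (intro add_left_mono mult_right_mono) auto
  also have "\<dots> = M\<^sup>2 * (w\<^sup>2 + a * \<delta>\<^sup>2)" by algebra
  also have "\<dots> \<le> M\<^sup>2 * u\<^sup>2" using assms(7) by (intro mult_left_mono) auto
  finally have "(M * w + \<delta>)\<^sup>2 \<le> (M * u)\<^sup>2" by (simp add: power_mult_distrib)
  then have "M * w + \<delta> \<le> M * u"
    by (rule power2_le_imp_le) (use M assms in auto)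
  then show ?thesis by (simp add: algebra_simps)
qed

text \<open>The bound \<open>kl\<close> is available only for iterates in a ball around
  \<open>l\<close>, so convergence and confinement to the ball have to be shown together; the
  potential \<open>\<Phi>\<close> controls both.\<close>

lemma descent_sequence_converges:
  fixes x :: "nat \<Rightarrow> 'a::real_normed_vector" and e :: "nat \<Rightarrow> real"
  assumes a: "a > 0" and \<kappa>: "\<kappa> \<ge> 0" and \<epsilon>: "\<epsilon> > 0"
    and dec: "\<And>k. a * (norm (x (Suc k) - x k))\<^sup>2 \<le> e k - e (Suc k)"
    and e0: "e \<longlonglongrightarrow> 0"
    and kl: "\<forall>\<^sub>F k in sequentially. norm (x (Suc k) - l) < \<epsilon> \<longrightarrow> e (Suc k) \<le> (\<kappa> * norm (x (Suc k) - x k))\<^sup>2"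
    and s: "strict_mono s" and lim: "(x \<circ> s) \<longlonglongrightarrow> l"
  shows "x \<longlonglongrightarrow> l"
proof -
  have "decseq e"
  proof (rule decseq_SucI)
    fix k
    have "0 \<le> a * (norm (x (Suc k) - x k))\<^sup>2" using a by simp
    then show "e (Suc k) \<le> e k" using dec[of k] by linarith
  qed
  then have epos: "e k \<ge> 0" for k using e0 by (rule decseq_ge)
  obtain N where N: "\<And>k. k \<ge> N \<Longrightarrow> norm (x (Suc k) - l) < \<epsilon> \<Longrightarrow> e (Suc k) \<le> (\<kappa> * norm (x (Suc k) - x k))\<^sup>2"
    using kl unfolding eventually_sequentially by blast
  define M where "M = (2 * \<kappa> + 1) / a + 1"
  have M1: "M \<ge> 1" and Ma: "1 / a \<le> M"
    using a \<kappa> by (auto simp: M_def field_simps)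
  define \<Phi> where "\<Phi> k = norm (x k - l) + M * sqrt (e k)" for k
  have \<Phi>_step: "\<Phi> (Suc k) \<le> \<Phi> k" if "k \<ge> N" "\<Phi> k < \<epsilon>" for k
  proof -
    let ?\<delta> = "norm (x (Suc k) - x k)"
    have tri: "norm (x (Suc k) - l) \<le> norm (x k - l) + ?\<delta>"
      by (metis add.commute norm_diff_triangle_ineq diff_add_cancel norm_triangle_ineq add_diff_eq)
    \<comment> \<open>The sufficient decrease alone gives a crude step bound, which keeps the next
      iterate within \<open>\<epsilon>\<close> of \<open>l\<close>; only then does \<open>kl\<close>
      apply and yield the sharper bound.\<close>
    have "?\<delta>\<^sup>2 \<le> 1 / a * e k"
      using dec[of k] epos[of "Suc k"] a by (simp add: field_simps)
    also have "\<dots> \<le> M * M * e k"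
    proof (rule mult_right_mono)
      have "M * 1 \<le> M * M" using M1 by (intro mult_left_mono) auto
      then show "1 / a \<le> M * M" using Ma by simp
    qed (rule epos)
    also have "\<dots> = (M * sqrt (e k))\<^sup>2"
      using epos[of k] by (simp add: power_mult_distrib power2_eq_square)
    finally have "?\<delta> \<le> M * sqrt (e k)"
      by (rule power2_le_imp_le) (use M1 epos[of k] in auto)
    then have "norm (x (Suc k) - l) < \<epsilon>" using tri that(2) by (simp add: \<Phi>_def)
    then have "e (Suc k) \<le> (\<kappa> * ?\<delta>)\<^sup>2" using N that(1) by blast
    then have "sqrt (e (Suc k)) \<le> \<kappa> * ?\<delta>"
      using \<kappa> by (simp add: real_le_lsqrt)
    then have "?\<delta> \<le> M * (sqrt (e k) - sqrt (e (Suc k)))"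
      using a \<kappa> dec[of k] epos by (intro step_le_sqrt_diff[where a = a and \<kappa> = \<kappa>]) (auto simp: M_def)
    then show ?thesis using tri by (simp add: \<Phi>_def algebra_simps)
  qed
  have "(\<lambda>m. norm ((x \<circ> s) m - l) + M * sqrt ((e \<circ> s) m)) \<longlonglongrightarrow> norm (l - l) + M * sqrt 0"
    using LIMSEQ_subseq_LIMSEQ[OF e0 s] by (intro tendsto_intros lim)
  then have \<Phi>s: "(\<lambda>m. \<Phi> (s m)) \<longlonglongrightarrow> 0" by (simp add: \<Phi>_def)
  show ?thesis
  proof (rule LIMSEQ_I)
    fix \<epsilon>' :: real assume "\<epsilon>' > 0"
    have "\<forall>\<^sub>F m in sequentially. \<Phi> (s m) < min \<epsilon> \<epsilon>'"
      using \<Phi>s \<open>\<epsilon>' > 0\<close> \<epsilon> by (intro order_tendstoD(2)[OF \<Phi>s]) auto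
    moreover have "\<forall>\<^sub>F m in sequentially. s m \<ge> N"
      using filterlim_subseq[OF s] by (simp add: filterlim_at_top)
    ultimately have "\<forall>\<^sub>F m in sequentially. \<Phi> (s m) < min \<epsilon> \<epsilon>' \<and> s m \<ge> N"
      by (rule eventually_conj)
    then obtain m where m: "\<Phi> (s m) < min \<epsilon> \<epsilon>'" "s m \<ge> N"
      using eventually_happens'[OF sequentially_bot] by blast
    \<comment> \<open>Staying below \<open>\<epsilon>\<close> is what allows
      \<open>\<Phi>_step\<close> to be applied again at each index.\<close>
    have "\<Phi> k < min \<epsilon> \<epsilon>'" if "k \<ge> s m" for k
      using that
    proof (induction k rule: dec_induct)
      case base
      show ?case by (rule m)
    next
      case (step k)
      then show ?case using \<Phi>_step[of k] m(2) by simp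
    qed
    moreover have "norm (x k - l) \<le> \<Phi> k" for k
      using M1 epos[of k] by (simp add: \<Phi>_def)
    ultimately show "\<exists>no. \<forall>n\<ge>no. norm (x n - l) < \<epsilon>'"
      by (metis min_less_iff_conj order_le_less_trans)
  qed
qed

section \<open>Strong convexity and supporting lines\<close>

text \<open>Comparing the minimum with the value a fraction \<open>u\<close> along the segment from
  \<open>a\<close> to \<open>t\<close> gives the bound with an extra factor \<open>1 - u\<close>,
  which disappears as \<open>u\<close> tends to 0. Only values are compared, so kinks of
  \<open>\<phi>\<close> do no harm.\<close>

lemma minimizer_quadratic_growth:
  fixes \<phi> :: "real \<Rightarrow> real"
  assumes conv: "convex_on UNIV (\<lambda>t. \<phi> t - \<mu> / 2 * t\<^sup>2)"
    and min: "\<And>t. \<phi> a \<le> \<phi> t"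
  shows "\<mu> / 2 * (t - a)\<^sup>2 \<le> \<phi> t - \<phi> a"
proof -
  have "(1 - u) * (\<mu> / 2 * (t - a)\<^sup>2) \<le> \<phi> t - \<phi> a" if u: "0 < u" "u < 1" for u
  proof -
    let ?c = "(1 - u) * a + u * t"
    have "\<phi> ?c - \<mu> / 2 * ?c\<^sup>2 \<le> (1 - u) * (\<phi> a - \<mu> / 2 * a\<^sup>2) + u * (\<phi> t - \<mu> / 2 * t\<^sup>2)"
      using convex_onD[OF conv, of u a t] u by simp
    then have "\<phi> a \<le> (1 - u) * (\<phi> a - \<mu> / 2 * a\<^sup>2) + u * (\<phi> t - \<mu> / 2 * t\<^sup>2) + \<mu> / 2 * ?c\<^sup>2"
      using min[of ?c] by simp
    also have "\<dots> = \<phi> a + u * ((\<phi> t - \<phi> a) - (1 - u) * (\<mu> / 2 * (t - a)\<^sup>2))"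
      by (simp add: field_simps power2_eq_square)
    finally show ?thesis using u(1) by (simp add: zero_le_mult_iff)
  qed
  then have "\<forall>\<^sub>F u in at_right 0. (1 - u) * (\<mu> / 2 * (t - a)\<^sup>2) \<le> \<phi> t - \<phi> a"
    unfolding eventually_at_right_field by (intro exI[of _ 1]) auto
  moreover have "((\<lambda>u. (1 - u) * (\<mu> / 2 * (t - a)\<^sup>2)) \<longlongrightarrow> (1 - 0) * (\<mu> / 2 * (t - a)\<^sup>2)) (at_right 0)"
    by (intro tendsto_intros)
  ultimately show ?thesis
    using tendsto_upperbound[of _ _ "at_right (0::real)"] by fastforce
qed

lemma convex_on_of_supports:
  fixes h :: "real \<Rightarrow> real"
  assumes "\<And>a. \<exists>g. \<forall>t. h a + g * (t - a) \<le> h t"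
  shows "convex_on UNIV h"
proof (rule convex_onI)
  fix u x y :: real assume u: "0 < u" "u < 1"
  let ?a = "(1 - u) *\<^sub>R x + u *\<^sub>R y"
  obtain g where g: "\<And>t. h ?a + g * (t - ?a) \<le> h t" using assms by blast
  have "(1 - u) * (h ?a + g * (x - ?a)) + u * (h ?a + g * (y - ?a)) \<le> (1 - u) * h x + u * h y"
    using u by (intro add_mono mult_left_mono g) auto
  then show "h ?a \<le> (1 - u) * h x + u * h y" by (simp add: algebra_simps)
qed simp

text \<open>The slope at a negative point is the negated slope at its mirror image. Since
  \<open>g \<ge> 0\<close>, the reflected line at \<open>t\<close> lies below the original one at
  \<open>\<bar>t\<bar>\<close>, so supports on the nonnegative axis suffice.\<close>

lemma convex_on_even_of_supports:
  fixes h :: "real \<Rightarrow> real"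
  assumes even: "\<And>t. h (- t) = h t"
    and supp: "\<And>a. a \<ge> 0 \<Longrightarrow> \<exists>g\<ge>0. \<forall>t\<ge>0. h a + g * (t - a) \<le> h t"
  shows "convex_on UNIV h"
proof (rule convex_on_of_supports)
  fix a
  have habs: "h \<bar>t\<bar> = h t" for t using even[of t] by (simp add: abs_if)
  obtain g where g: "g \<ge> 0" "\<And>t. t \<ge> 0 \<Longrightarrow> h \<bar>a\<bar> + g * (t - \<bar>a\<bar>) \<le> h t"
    using supp[of "\<bar>a\<bar>"] by auto
  have "h a + (if a < 0 then - g else g) * (t - a) \<le> h t" for t
  proof -
    have "(if a < 0 then - g else g) * (t - a) \<le> g * (\<bar>t\<bar> - \<bar>a\<bar>)"
      using mult_left_mono[of t "\<bar>t\<bar>" g] mult_left_mono[of "- t" "\<bar>t\<bar>" g] g(1)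
      by (auto simp: algebra_simps)
    then show ?thesis using g(2)[of "\<bar>t\<bar>"] by (simp add: habs)
  qed
  then show "\<exists>g. \<forall>t. h a + g * (t - a) \<le> h t" by blast
qed

section \<open>The MCP and SCAD penalties\<close>

text \<open>Adding the square leaves, for \<open>t \<ge> 0\<close>, \<open>lam * t\<close> up to
  \<open>\<gamma> * lam\<close> and
  \<open>(t\<^sup>2 + (\<gamma> * lam)\<^sup>2) / (2 * \<gamma>)\<close> beyond. Both pieces have
  slope \<open>lam\<close> at the junction, so the slope never decreases.\<close>

lemma mcp_convex:
  assumes "lam \<ge> 0" "\<gamma> > 1"
  shows "convex_on UNIV (\<lambda>t. mcp lam \<gamma> t + 1 / \<gamma> / 2 * t\<^sup>2)" (is "convex_on _ ?h")
proof (rule convex_on_even_of_supports)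
  show "?h (- t) = ?h t" for t by (simp add: mcp_def)
  fix a :: real assume a: "a \<ge> 0"
  \<comment> \<open>The derivative of \<open>?h\<close> at \<open>a\<close>, taken from the right at
    \<open>a = 0\<close>.\<close>
  let ?g = "if a \<le> \<gamma> * lam then lam else a / \<gamma>"
  have hin: "2 * \<gamma> * ?h t = 2 * \<gamma> * lam * t" if "t \<ge> 0" "t \<le> \<gamma> * lam" for t
    using that assms by (simp add: mcp_def field_simps)
  have hout: "2 * \<gamma> * ?h t = t\<^sup>2 + (\<gamma> * lam)\<^sup>2" if "t \<ge> 0" "\<not> t \<le> \<gamma> * lam" for t
    using that assms by (simp add: mcp_def field_simps power2_eq_square)
  have "?h a + ?g * (t - a) \<le> ?h t" if t: "t \<ge> 0" for t
  proof -
    \<comment> \<open>The factor \<open>2 * \<gamma>\<close> clears denominators; in the four cases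
      the gap is zero, a square, or a product of two nonnegative factors.\<close>
    have "2 * \<gamma> * ?h a + 2 * \<gamma> * ?g * (t - a) \<le> 2 * \<gamma> * ?h t"
    proof (cases "a \<le> \<gamma> * lam"; cases "t \<le> \<gamma> * lam")
      assume "a \<le> \<gamma> * lam" "\<not> t \<le> \<gamma> * lam"
      moreover have "2 * (\<gamma> * lam) * t \<le> t\<^sup>2 + (\<gamma> * lam)\<^sup>2"
        using zero_le_power2[of "t - \<gamma> * lam"] by (simp add: power2_diff mult_ac)
      ultimately show ?thesis using a t by (subst hin hout, simp, simp)+ (simp add: algebra_simps)
    next
      assume c: "\<not> a \<le> \<gamma> * lam" "t \<le> \<gamma> * lam"
      then have "0 \<le> (a - \<gamma> * lam) * (a + \<gamma> * lam - 2 * t)" by (intro mult_nonneg_nonneg) auto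
      then show ?thesis using a t c assms by (subst hin hout, simp, simp)+ (simp add: algebra_simps power2_eq_square)
    next
      assume c: "\<not> a \<le> \<gamma> * lam" "\<not> t \<le> \<gamma> * lam"
      show ?thesis using a t c assms zero_le_power2[of "t - a"]
        by (subst hin hout, simp, simp)+ (simp add: algebra_simps power2_eq_square)
    next
      assume c: "a \<le> \<gamma> * lam" "t \<le> \<gamma> * lam"
      show ?thesis using a t c by (subst hin hout, simp, simp)+ (simp add: algebra_simps)
    qed
    then have "2 * \<gamma> * (?h a + ?g * (t - a)) \<le> 2 * \<gamma> * ?h t" by (simp only: ring_distribs mult.assoc)
    then show ?thesis using assms by (simp only: mult_le_cancel_left_pos)
  qed
  moreover have "?g \<ge> 0" using assms a by simp
  ultimately show "\<exists>g\<ge>0. \<forall>t\<ge>0. ?h a + g * (t - a) \<le> ?h t" by blast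
qed

text \<open>The coefficients depend on \<open>sgn d\<close> so that the two sides may differ, as at
  a kink: \<open>p\<close> and \<open>q\<close> are the one-sided first and second derivatives at
  \<open>a\<close>. Both expansions start from the value \<open>r a\<close>.\<close>

definition locally_quadratic :: "(real \<Rightarrow> real) \<Rightarrow> bool" where
  "locally_quadratic r \<longleftrightarrow> (\<forall>a. \<exists>\<delta>>0. \<exists>p q. \<forall>d. d \<noteq> 0 \<longrightarrow> \<bar>d\<bar> < \<delta> \<longrightarrow>
     r (a + d) = r a + p (sgn d) * d + q (sgn d) / 2 * d\<^sup>2)"

text \<open>The expansion to the left of \<open>a\<close> is the reflection of the one to the right
  of \<open>- a\<close>, so only right neighbourhoods need checking. \<open>?p\<close> and
  \<open>?q\<close> arise by re-expanding the two polynomials around \<open>a\<close>.\<close>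

lemma locally_quadratic_even:
  assumes even: "\<And>t. r (- t) = r t"
    and right: "\<And>a. \<exists>u>a. \<exists>A B C. \<forall>t\<in>{a..<u}. r t = A + B * t + C * t\<^sup>2"
  shows "locally_quadratic r"
  unfolding locally_quadratic_def
proof
  fix a
  obtain u A B C where 1: "u > a" "\<And>t. t \<in> {a..<u} \<Longrightarrow> r t = A + B * t + C * t\<^sup>2"
    using right by metis
  obtain u' A' B' C' where 2: "u' > - a" "\<And>t. t \<in> {-a..<u'} \<Longrightarrow> r t = A' + B' * t + C' * t\<^sup>2"
    using right by metis
  let ?p = "\<lambda>s::real. if s > 0 then B + 2 * C * a else 2 * C' * a - B'"
  let ?q = "\<lambda>s::real. if s > 0 then 2 * C else 2 * C'"
  have "r (a + d) = r a + ?p (sgn d) * d + ?q (sgn d) / 2 * d\<^sup>2"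
    if d: "d \<noteq> 0" "\<bar>d\<bar> < min (u - a) (u' + a)" for d
  proof (cases "d > 0")
    case True
    then show ?thesis
      using 1(2)[of a] 1(2)[of "a + d"] 1(1) d by (simp add: algebra_simps power2_eq_square)
  next
    case False
    then have "r (a + d) = A' + B' * - (a + d) + C' * (- (a + d))\<^sup>2"
      using 2(2)[of "- (a + d)"] even[of "a + d"] d by simp
    moreover have "r a = A' + B' * - a + C' * (- a)\<^sup>2"
      using 2(2)[of "- a"] even[of a] 2(1) by simp
    ultimately show ?thesis
      using False by (simp add: algebra_simps power2_eq_square)
  qed
  then show "\<exists>\<delta>>0. \<exists>p q. \<forall>d. d \<noteq> 0 \<longrightarrow> \<bar>d\<bar> < \<delta> \<longrightarrow>
     r (a + d) = r a + p (sgn d) * d + q (sgn d) / 2 * d\<^sup>2"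
    using 1(1) 2(1) by (intro exI[of _ "min (u - a) (u' + a)"] conjI exI[of _ ?p] exI[of _ ?q]) auto
qed

lemma mcp_locally_quadratic:
  assumes "lam \<ge> 0" "\<gamma> > 1"
  shows "locally_quadratic (mcp lam \<gamma>)"
proof (rule locally_quadratic_even)
  show "mcp lam \<gamma> (- t) = mcp lam \<gamma> t" for t by (simp add: mcp_def)
  fix a :: real
  let ?K = "\<gamma> * lam"
  have K: "?K \<ge> 0" using assms by simp
  \<comment> \<open>The ranges are closed on the left and open on the right, so that each contains a
    right neighbourhood of each of its points.\<close>
  consider "a < - ?K" | "- ?K \<le> a" "a < 0" | "0 \<le> a" "a < ?K" | "?K \<le> a" by linarith
  then show "\<exists>u>a. \<exists>A B C. \<forall>t\<in>{a..<u}. mcp lam \<gamma> t = A + B * t + C * t\<^sup>2"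
  proof cases
    case 1
    have "\<forall>t\<in>{a..<- ?K}. mcp lam \<gamma> t = \<gamma> * lam\<^sup>2 / 2 + 0 * t + 0 * t\<^sup>2"
      using K by (auto simp: mcp_def)
    with 1 show ?thesis by blast
  next
    case 2
    have "\<forall>t\<in>{a..<0}. mcp lam \<gamma> t = 0 + (- lam) * t + (- 1 / (2 * \<gamma>)) * t\<^sup>2"
      using K 2 by (auto simp: mcp_def)
    with 2 show ?thesis by blast
  next
    case 3
    have "\<forall>t\<in>{a..<?K}. mcp lam \<gamma> t = 0 + lam * t + (- 1 / (2 * \<gamma>)) * t\<^sup>2"
      using K 3 by (auto simp: mcp_def)
    with 3 show ?thesis by blast
  next
    case 4
    \<comment> \<open>At the breakpoint the definition selects the inner branch, whose value agrees
      with the plateau.\<close>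
    have "mcp lam \<gamma> ?K = \<gamma> * lam\<^sup>2 / 2"
      using K assms by (simp add: mcp_def field_simps power2_eq_square)
    then have "mcp lam \<gamma> t = \<gamma> * lam\<^sup>2 / 2 + 0 * t + 0 * t\<^sup>2" if "?K \<le> t" for t
      using that K by (cases "t = ?K") (auto simp: mcp_def)
    with 4 show ?thesis by (intro exI[of _ "a + 1"]) (meson order_trans atLeastLessThan_iff less_add_one)
  qed
qed

lemma scad_locally_quadratic:
  assumes "lam \<ge> 0" "\<gamma> > 2"
  shows "locally_quadratic (scad lam \<gamma>)"
proof (rule locally_quadratic_even)
  show "scad lam \<gamma> (- t) = scad lam \<gamma> t" for t by (simp add: scad_def)
  fix a :: real
  let ?K = "\<gamma> * lam" and ?O = "lam\<^sup>2 * (\<gamma>\<^sup>2 - 1) / (2 * (\<gamma> - 1))"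
  let ?A = "- lam\<^sup>2 / (2 * (\<gamma> - 1))" and ?B = "2 * \<gamma> * lam / (2 * (\<gamma> - 1))" and ?C = "- 1 / (2 * (\<gamma> - 1))"
  have K: "?K \<ge> lam" using assms mult_right_mono[of 1 \<gamma> lam] by simp
  \<comment> \<open>Adjacent branches agree at the breakpoints. Hence the middle formula extends to
    \<open>\<bar>t\<bar> = lam\<close>, and the plateau in \<open>out\<close> to
    \<open>\<bar>t\<bar> = ?K\<close>, where right neighbourhoods begin.\<close>
  have mid: "scad lam \<gamma> t = ?A + ?B * \<bar>t\<bar> + ?C * t\<^sup>2" if "lam \<le> \<bar>t\<bar>" "\<bar>t\<bar> \<le> ?K" for t
  proof (cases "\<bar>t\<bar> = lam")
    case True
    then have t2: "t\<^sup>2 = lam\<^sup>2" by (metis power2_abs)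
    have "?A + ?B * \<bar>t\<bar> + ?C * t\<^sup>2 = (2 * (\<gamma> - 1) * lam\<^sup>2) / (2 * (\<gamma> - 1))"
      unfolding True t2 by (simp add: algebra_simps power2_eq_square flip: add_divide_distrib diff_divide_distrib)
    also have "\<dots> = lam\<^sup>2" using assms by simp
    finally show ?thesis using True by (simp add: scad_def power2_eq_square)
  next
    case False
    with that show ?thesis by (simp add: scad_def add_divide_distrib diff_divide_distrib)
  qed
  have out: "scad lam \<gamma> t = ?O" if "?K \<le> \<bar>t\<bar>" for t
  proof (cases "\<bar>t\<bar> = ?K")
    case True
    then have t2: "t\<^sup>2 = ?K\<^sup>2" by (metis power2_abs)
    have "scad lam \<gamma> t = ?A + ?B * \<bar>t\<bar> + ?C * t\<^sup>2" using True K by (intro mid) auto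
    also have "\<dots> = ?O"
      unfolding True t2 by (simp add: algebra_simps power2_eq_square flip: add_divide_distrib diff_divide_distrib)
    finally show ?thesis .
  next
    case False
    with that K show ?thesis by (simp add: scad_def)
  qed
  consider "a < - ?K" | "- ?K \<le> a" "a < - lam" | "- lam \<le> a" "a < 0" | "0 \<le> a" "a < lam"
    | "lam \<le> a" "a < ?K" | "?K \<le> a" by linarith
  then show "\<exists>u>a. \<exists>A B C. \<forall>t\<in>{a..<u}. scad lam \<gamma> t = A + B * t + C * t\<^sup>2"
  proof cases
    case 1
    have "\<forall>t\<in>{a..<- ?K}. scad lam \<gamma> t = ?O + 0 * t + 0 * t\<^sup>2"
    proof
      show "scad lam \<gamma> t = ?O + 0 * t + 0 * t\<^sup>2" if "t \<in> {a..<- ?K}" for t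
      proof -
        have "?K \<le> \<bar>t\<bar>" using that by simp linarith
        from out[OF this] show ?thesis by simp
      qed
    qed
    with 1 show ?thesis by blast
  next
    case 2
    have "\<forall>t\<in>{a..<- lam}. scad lam \<gamma> t = ?A + (- ?B) * t + ?C * t\<^sup>2"
      using assms 2 by (auto simp: mid)
    with 2 show ?thesis by blast
  next
    case 3
    have "\<forall>t\<in>{a..<0}. scad lam \<gamma> t = 0 + (- lam) * t + 0 * t\<^sup>2"
      using 3 by (auto simp: scad_def)
    with 3 show ?thesis by blast
  next
    case 4
    have "\<forall>t\<in>{a..<lam}. scad lam \<gamma> t = 0 + lam * t + 0 * t\<^sup>2"
      using 4 by (auto simp: scad_def)
    with 4 show ?thesis by blast
  next
    case 5
    have "\<forall>t\<in>{a..<?K}. scad lam \<gamma> t = ?A + ?B * t + ?C * t\<^sup>2"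
      using assms 5 by (auto simp: mid)
    with 5 show ?thesis by blast
  next
    case 6
    have "\<forall>t\<in>{a..<a + 1}. scad lam \<gamma> t = ?O + 0 * t + 0 * t\<^sup>2"
    proof
      show "scad lam \<gamma> t = ?O + 0 * t + 0 * t\<^sup>2" if "t \<in> {a..<a + 1}" for t
      proof -
        have "?K \<le> \<bar>t\<bar>" using that 6 by simp linarith
        from out[OF this] show ?thesis by simp
      qed
    qed
    then show ?thesis by (meson less_add_one)
  qed
qed

text \<open>The added square cancels the concavity of the middle branch. After scaling by
  \<open>2 * c\<close>, the pieces on the nonnegative axis are quadratic, linear, quadratic, with
  slopes \<open>G\<close> that agree (\<open>2 * ?K\<close>) at both breakpoints and never
  decrease.\<close>

lemma scad_convex:
  assumes "lam \<ge> 0" "\<gamma> > 2"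
  shows "convex_on UNIV (\<lambda>t. scad lam \<gamma> t + 1 / (\<gamma> - 1) / 2 * t\<^sup>2)" (is "convex_on _ ?h")
proof (rule convex_on_even_of_supports)
  show "?h (- t) = ?h t" for t by (simp add: scad_def)
  fix a :: real assume a: "a \<ge> 0"
  let ?K = "\<gamma> * lam"
  define c where "c = \<gamma> - 1"
  have c: "c > 1" "\<gamma> = c + 1" using assms by (auto simp: c_def)
  have K: "?K \<ge> lam" using assms mult_right_mono[of 1 \<gamma> lam] by simp
  define H where "H t = 2 * c * ?h t" for t
  define G where "G = (if a \<le> lam then 2 * a + 2 * c * lam else if a \<le> ?K then 2 * ?K else 2 * a)"
  have H1: "H t = t\<^sup>2 + 2 * c * lam * t" if "t \<ge> 0" "t \<le> lam" for t
    using that c(1) by (simp add: H_def scad_def c(2) field_simps)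
  have H2: "H t = 2 * ?K * t - lam\<^sup>2" if "t \<ge> 0" "lam < t" "t \<le> ?K" for t
    using that c(1) assms by (simp add: H_def scad_def c(2) field_simps)
  have H3: "H t = t\<^sup>2 + ?K\<^sup>2 - lam\<^sup>2" if "t \<ge> 0" "lam < t" "?K < t" for t
    using that c(1) assms by (simp add: H_def scad_def c(2) field_simps power2_eq_square)
  have supp: "H a + G * (t - a) \<le> H t" if t: "t \<ge> 0" for t
  proof -
    consider "a \<le> lam" | "lam < a" "a \<le> ?K" | "lam < a" "?K < a" using K by linarith
    then show ?thesis
    proof cases
      case a1: 1
      consider "t \<le> lam" | "lam < t" "t \<le> ?K" | "lam < t" "?K < t" using K by linarith
      then show ?thesis
      proof cases
        case 1
        then show ?thesis using a1 a t zero_le_power2[of "t - a"]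
          by (simp add: H1 G_def algebra_simps power2_eq_square)
      next
        case 2
        \<comment> \<open>This product is exactly the gap \<open>H t - H a - G * (t - a)\<close>. In
          the remaining cases the gap is likewise zero or a sum of squares and such
          products.\<close>
        have "0 \<le> (lam - a) * (2 * t - lam - a)" using a1 2 by (intro mult_nonneg_nonneg) auto
        then show ?thesis using a1 2 a t by (simp add: H1 H2 G_def c(2) algebra_simps power2_eq_square)
      next
        case 3
        have "0 \<le> (lam - a) * (2 * t - lam - a) + (t - ?K)\<^sup>2" using a1 3 by (intro add_nonneg_nonneg mult_nonneg_nonneg) auto
        then show ?thesis using a1 3 a t by (simp add: H1 H3 G_def c(2) algebra_simps power2_eq_square)
      qed
    next
      case a2: 2
      consider "t \<le> lam" | "lam < t" "t \<le> ?K" | "lam < t" "?K < t" using K by linarith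
      then show ?thesis
      proof cases
        case 1
        then show ?thesis using a2 a t zero_le_power2[of "t - lam"]
          by (simp add: H1 H2 G_def c(2) algebra_simps power2_eq_square)
      next
        case 2
        then show ?thesis using a2 a t by (simp add: H2 G_def algebra_simps)
      next
        case 3
        then show ?thesis using a2 a t zero_le_power2[of "t - ?K"]
          by (simp add: H2 H3 G_def c(2) algebra_simps power2_eq_square)
      qed
    next
      case a3: 3
      consider "t \<le> lam" | "lam < t" "t \<le> ?K" | "lam < t" "?K < t" using K by linarith
      then show ?thesis
      proof cases
        case 1
        have "0 \<le> (a - ?K) * (a + ?K - 2 * t) + (t - lam)\<^sup>2"
          using a3 1 K by (intro add_nonneg_nonneg mult_nonneg_nonneg) auto
        then show ?thesis using a3 1 a t
          by (simp add: H1 H3 G_def c(2) algebra_simps power2_eq_square)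
      next
        case 2
        have "0 \<le> (a - ?K) * (a + ?K - 2 * t)"
          using a3 2 K by (intro mult_nonneg_nonneg) auto
        then show ?thesis using a3 2 a t
          by (simp add: H2 H3 G_def c(2) algebra_simps power2_eq_square)
      next
        case 3
        then show ?thesis using a3 a t zero_le_power2[of "t - a"]
          by (simp add: H3 G_def algebra_simps power2_eq_square)
      qed
    qed
  qed
  have "2 * c * (?h a + G / (2 * c) * (t - a)) \<le> 2 * c * ?h t" if "t \<ge> 0" for t
  proof -
    have "2 * c * (?h a + G / (2 * c) * (t - a)) = 2 * c * ?h a + G * (t - a)"
      using c(1) by (simp add: distrib_left)
    then show ?thesis using supp[OF that] by (simp only: H_def)
  qed
  then have "?h a + G / (2 * c) * (t - a) \<le> ?h t" if "t \<ge> 0" for t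
    using that c(1) by (simp only: mult_le_cancel_left_pos)
  moreover have "G / (2 * c) \<ge> 0" using a assms c(1) by (simp add: G_def)
  ultimately show "\<exists>g\<ge>0. \<forall>t\<ge>0. ?h a + g * (t - a) \<le> ?h t" by blast
qed

text \<open>Nonnegative penalties bound the objective from below, so its decreasing values along the
  iterates converge.\<close>

lemma mcp_nonneg:
  assumes "lam \<ge> 0" "\<gamma> > 1"
  shows "mcp lam \<gamma> t \<ge> 0"
proof (cases "\<bar>t\<bar> \<le> \<gamma> * lam")
  case True
  have "\<bar>t\<bar> * \<bar>t\<bar> \<le> (2 * \<gamma> * lam) * \<bar>t\<bar>"
    using True assms by (intro mult_right_mono) auto
  then show ?thesis using True assms by (simp add: mcp_def field_simps power2_eq_square)
next
  case False
  then show ?thesis using assms by (simp add: mcp_def)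
qed

lemma scad_nonneg:
  assumes "lam \<ge> 0" "\<gamma> > 2"
  shows "scad lam \<gamma> t \<ge> 0"
proof (cases "lam < \<bar>t\<bar> \<and> \<bar>t\<bar> \<le> \<gamma> * lam")
  case True
  have "\<bar>t\<bar> * \<bar>t\<bar> \<le> (\<gamma> * lam) * \<bar>t\<bar>" using True by (intro mult_right_mono) auto
  moreover have "lam * lam \<le> \<gamma> * (lam * \<bar>t\<bar>)"
    using True assms mult_mono[of 1 \<gamma> "lam * lam" "lam * \<bar>t\<bar>"] mult_left_mono[of lam "\<bar>t\<bar>" lam] by simp
  ultimately show ?thesis using True assms by (simp add: scad_def field_simps power2_eq_square)
next
  case False
  have "\<gamma>\<^sup>2 \<ge> 1" using assms by (simp add: one_le_power)
  then show ?thesis using False assms by (auto simp: scad_def)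
qed

section \<open>The penalized least squares objective\<close>

definition ls_gradient :: "real^'p^'n \<Rightarrow> real^'n \<Rightarrow> real^'p \<Rightarrow> real^'p" where
  "ls_gradient X y b = (\<chi> j. 1 / real CARD('n) * (column j X \<bullet> (X *v b - y)))"

lemma inner_matrix_vector_mult:
  fixes X :: "real^'p^'n"
  shows "w \<bullet> (X *v d) = (\<Sum>j\<in>UNIV. (column j X \<bullet> w) * d $ j)"
  by (simp add: matrix_mult_sum inner_sum_right inner_commute scalar_mult_eq_scaleR mult.commute)

lemma ls_gradient_add:
  "ls_gradient X y (b + d) $ j
     = ls_gradient X y b $ j + 1 / real CARD('n) * (column j (X :: real^'p^'n) \<bullet> (X *v d))"
  by (simp add: ls_gradient_def matrix_vector_right_distrib inner_add_right inner_diff_right algebra_simps)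

lemma penalized_ls_add:
  fixes X :: "real^'p^'n"
  shows "penalized_ls X y r (b + d) = penalized_ls X y r b + (\<Sum>j\<in>UNIV. ls_gradient X y b $ j * d $ j)
    + 1 / (2 * real CARD('n)) * (norm (X *v d))\<^sup>2 + (\<Sum>j\<in>UNIV. r (b $ j + d $ j) - r (b $ j))"
proof -
  have "(norm (X *v (b + d) - y))\<^sup>2
      = (norm (X *v b - y))\<^sup>2 + 2 * ((X *v b - y) \<bullet> (X *v d)) + (norm (X *v d))\<^sup>2"
    by (simp add: power2_norm_eq_inner matrix_vector_right_distrib inner_add_left inner_add_right
        inner_diff_left inner_diff_right inner_commute algebra_simps)
  moreover have "(\<Sum>j\<in>UNIV. ls_gradient X y b $ j * d $ j) = 1 / real CARD('n) * ((X *v b - y) \<bullet> (X *v d))"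
    by (simp add: inner_matrix_vector_mult ls_gradient_def sum_distrib_left mult.assoc)
  ultimately show ?thesis
    by (simp add: penalized_ls_def sum_subtractf field_simps)
qed

lemma norm_column_standardized:
  fixes X :: "real^'p^'n"
  assumes "standardized X y"
  shows "(norm (column j X))\<^sup>2 = real CARD('n)"
  unfolding power2_norm_eq_inner
  using assms by (simp add: standardized_def inner_vec_def column_def power2_eq_square field_simps)

definition set_coord :: "real^'p \<Rightarrow> 'p \<Rightarrow> real \<Rightarrow> real^'p" where
  "set_coord b j t = (\<chi> i. if i = j then t else b $ i)"

text \<open>The quadratic term of the update has the exact curvature of the least squares part, so
  the update minimizes the full objective in coordinate \<open>j\<close>. The assumption says that
  this coordinate has not yet been changed in the current cycle.\<close>

lemma penalized_ls_set_coord: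
  fixes X :: "real^'p^'n"
  assumes "z $ j = b $ j"
  shows "penalized_ls X y r (set_coord z j t) - penalized_ls X y r (set_coord z j t')
    = cd_objective X y r b z j t - cd_objective X y r b z j t'"
proof -
  have "penalized_ls X y r (set_coord z j t) = penalized_ls X y r z + cd_objective X y r b z j t
      - ls_gradient X y z $ j * b $ j - r (b $ j)" for t
  proof -
    have eq: "set_coord z j t = z + axis j (t - b $ j)"
      using assms by (simp add: vec_eq_iff set_coord_def axis_def)
    have ax: "axis j (t - b $ j) $ i = (if i = j then t - b $ j else 0)" for i
      by (simp add: axis_def)
    have "X *v axis j (t - b $ j) = (t - b $ j) *\<^sub>R column j X"
      by (simp add: matrix_mult_sum ax scalar_mult_eq_scaleR if_distrib[of "\<lambda>c. c *\<^sub>R _"] cong: if_cong)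
    then have n: "(norm (X *v axis j (t - b $ j)))\<^sup>2 = (norm (column j X))\<^sup>2 * (t - b $ j)\<^sup>2"
      by (simp add: power_mult_distrib)
    have s1: "(\<Sum>i\<in>UNIV. ls_gradient X y z $ i * axis j (t - b $ j) $ i) = ls_gradient X y z $ j * (t - b $ j)"
      by (simp add: ax if_distrib[of "\<lambda>c. _ * c"] cong: if_cong)
    have "(\<Sum>i\<in>UNIV. r (z $ i + axis j (t - b $ j) $ i) - r (z $ i))
        = (\<Sum>i\<in>UNIV. if i = j then r t - r (b $ j) else 0)"
      using assms by (intro sum.cong) (auto simp: ax)
    then have s2: "(\<Sum>i\<in>UNIV. r (z $ i + axis j (t - b $ j) $ i) - r (z $ i)) = r t - r (b $ j)"
      by simp
    show ?thesis
      unfolding eq penalized_ls_add n s1 s2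
      by (simp add: cd_objective_def ls_gradient_def algebra_simps add_divide_distrib diff_divide_distrib)
  qed
  then show ?thesis by simp
qed

section \<open>Local bound of the excess by the gradient\<close>

lemma locally_quadratic_deriv:
  fixes r :: "real \<Rightarrow> real"
  assumes q: "\<And>d. d \<noteq> 0 \<Longrightarrow> \<bar>d\<bar> < \<delta> \<Longrightarrow> r (a + d) = r a + p (sgn d) * d + q (sgn d) / 2 * d\<^sup>2"
    and d: "d \<noteq> 0" "\<bar>d\<bar> < \<delta>"
  shows "(r has_real_derivative p (sgn d) + q (sgn d) * d) (at (a + d))"
proof -
  let ?g = "\<lambda>t. r a + p (sgn d) * (t - a) + q (sgn d) / 2 * (t - a)\<^sup>2"
  \<comment> \<open>On this side of \<open>a\<close> the sign of \<open>t - a\<close> is constant,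
    so a single quadratic describes \<open>r\<close>.\<close>
  let ?S = "if d > 0 then {a<..<a + \<delta>} else {a - \<delta><..<a}"
  have "(?g has_real_derivative p (sgn d) + q (sgn d) * d) (at (a + d))"
    by (auto intro!: derivative_eq_intros)
  moreover have "open ?S" "a + d \<in> ?S" using d by auto
  moreover have "?g t = r t" if "t \<in> ?S" for t
  proof -
    have "t - a \<noteq> 0" "\<bar>t - a\<bar> < \<delta>" "sgn (t - a) = sgn d"
      using that d by (auto split: if_splits)
    then show ?thesis using q[of "t - a"] by simp
  qed
  ultimately show ?thesis by (rule has_field_derivative_transform_within_open)
qed

text \<open>A Kurdyka--Lojasiewicz inequality with exponent one half.  Near \<open>l\<close>, the signs of \<open>x - l\<close>
  select one of finitely many quadratic pieces.  Wherever \<open>x\<close> and \<open>l\<close> differ, a small gradient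
  forces the linear part of the selected piece to vanish, which leaves a quadratic form.\<close>

lemma penalized_ls_error_bound:
  fixes X :: "real^'p^'n" and l :: "real^'p"
  assumes "locally_quadratic r"
  shows "\<exists>\<epsilon>>0. \<exists>\<kappa>\<ge>0. \<forall>x v. norm (x - l) < \<epsilon> \<longrightarrow> norm v < \<epsilon> \<longrightarrow>
    (\<forall>j D. (r has_real_derivative D) (at (x $ j)) \<longrightarrow> v $ j = ls_gradient X y x $ j + D) \<longrightarrow>
    penalized_ls X y r x - penalized_ls X y r l \<le> (\<kappa> * norm v)\<^sup>2"
proof -
  have "\<forall>j. \<exists>\<delta> p q. \<delta> > 0 \<and> (\<forall>d. d \<noteq> 0 \<longrightarrow> \<bar>d\<bar> < \<delta> \<longrightarrow>
      r (l $ j + d) = r (l $ j) + p (sgn d) * d + q (sgn d) / 2 * d\<^sup>2)"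
    using assms unfolding locally_quadratic_def by blast
  then obtain \<delta> p q where \<delta>: "\<And>j. \<delta> j > 0"
    and pq: "\<And>j d. d \<noteq> 0 \<Longrightarrow> \<bar>d\<bar> < \<delta> j \<Longrightarrow>
      r (l $ j + d) = r (l $ j) + p j (sgn d) * d + q j (sgn d) / 2 * d\<^sup>2"
    by metis
  define g where "g = ls_gradient X y l"
  define L where "L j d = 1 / real CARD('n) * (column j X \<bullet> (X *v d))" for j d
  \<comment> \<open>The Hessian of the piece selected by the signs \<open>\<sigma>\<close>, with the
    rows and columns of the coordinates with \<open>\<sigma> j = 0\<close> set to zero.\<close>
  define A where "A \<sigma> x = (\<chi> j. \<bar>\<sigma> j\<bar> * (L j (\<chi> i. \<bar>\<sigma> i\<bar> * x $ i) + q j (\<sigma> j) * x $ j))"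
    for \<sigma> :: "'p \<Rightarrow> real" and x :: "real^'p"
  have L_add: "L j (x + y) = L j x + L j y" and L_scale: "L j (c *\<^sub>R x) = c * L j x" for j x y c
    by (auto simp: L_def matrix_vector_right_distrib inner_add_right matrix_vector_mult_scaleR algebra_simps)
  have L_sum: "(\<Sum>j\<in>UNIV. x $ j * L j d) = 1 / real CARD('n) * ((X *v d) \<bullet> (X *v x))" for x d
    by (simp add: inner_matrix_vector_mult L_def sum_distrib_left mult_ac)
  have lin: "linear (A \<sigma>)" for \<sigma>
  proof (rule linearI)
    show "A \<sigma> (x + y) = A \<sigma> x + A \<sigma> y" for x y
    proof -
      have "(\<chi> i. \<bar>\<sigma> i\<bar> * (x + y) $ i) = (\<chi> i. \<bar>\<sigma> i\<bar> * x $ i) + (\<chi> i. \<bar>\<sigma> i\<bar> * y $ i)"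
        by (simp add: vec_eq_iff algebra_simps)
      then show ?thesis by (simp only: A_def L_add) (simp add: vec_eq_iff algebra_simps)
    qed
    show "A \<sigma> (c *\<^sub>R x) = c *\<^sub>R A \<sigma> x" for c x
    proof -
      have "(\<chi> i. \<bar>\<sigma> i\<bar> * (c *\<^sub>R x) $ i) = c *\<^sub>R (\<chi> i. \<bar>\<sigma> i\<bar> * x $ i)"
        by (simp add: vec_eq_iff)
      then show ?thesis by (simp only: A_def L_scale) (simp add: vec_eq_iff algebra_simps)
    qed
  qed
  have form: "x \<bullet> A \<sigma> y = (\<Sum>j\<in>UNIV. (\<chi> i. \<bar>\<sigma> i\<bar> * x $ i) $ j * L j (\<chi> i. \<bar>\<sigma> i\<bar> * y $ i))
      + (\<Sum>j\<in>UNIV. \<bar>\<sigma> j\<bar> * q j (\<sigma> j) * (x $ j * y $ j))" for x y \<sigma>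
    by (simp add: A_def inner_vec_def sum.distrib[symmetric] algebra_simps)
  have sym: "x \<bullet> A \<sigma> y = A \<sigma> x \<bullet> y" for x y \<sigma>
    by (subst inner_commute[of "A \<sigma> x"]) (simp only: form L_sum inner_commute mult.commute)
  have "\<exists>C. \<forall>x. x \<bullet> A \<sigma> x \<le> C * (norm (A \<sigma> x))\<^sup>2" for \<sigma>
    using symmetric_form_le_norm_square[OF lin sym] .
  then obtain C where C: "\<And>\<sigma> x. x \<bullet> A \<sigma> x \<le> C \<sigma> * (norm (A \<sigma> x))\<^sup>2" by metis
  \<comment> \<open>There are finitely many sign patterns, so one constant \<open>K\<close> serves
    all of them.\<close>
  define \<Sigma> :: "('p \<Rightarrow> real) set" where "\<Sigma> = {\<sigma>. \<forall>j. \<sigma> j \<in> {-1, 0, 1}}"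
  have "\<Sigma> = (\<Pi>\<^sub>E j\<in>UNIV. {-1, 0, 1})" by (auto simp: \<Sigma>_def PiE_UNIV_domain)
  then have fin: "finite \<Sigma>" by (simp add: finite_PiE)
  define K where "K = (\<Sum>\<sigma>\<in>\<Sigma>. \<bar>C \<sigma>\<bar>)"
  have "K \<ge> 0" by (auto simp: K_def intro: sum_nonneg)
  have CK: "C \<sigma> \<le> K" if "\<sigma> \<in> \<Sigma>" for \<sigma>
    using member_le_sum[OF that, of "\<lambda>\<sigma>. \<bar>C \<sigma>\<bar>"] fin by (simp add: K_def)
  \<comment> \<open>All slopes at \<open>l\<close> that the selected pieces can have; being finitely
    many, the nonzero ones are at least some \<open>\<eta> > 0\<close> in absolute value.\<close>
  let ?G = "(\<lambda>(j, s). g $ j + p j s) ` (UNIV \<times> {-1, 1})"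
  have "finite ?G" by simp
  from finite_set_avoid[OF this, of 0]
  obtain \<eta> where \<eta>: "\<eta> > 0" "\<forall>c\<in>?G. c \<noteq> 0 \<longrightarrow> \<eta> \<le> dist 0 c" by blast
  have "\<forall>\<^sub>F d in nhds 0. \<forall>j. \<bar>d $ j\<bar> < \<delta> j \<and> (\<forall>s\<in>{-1, 1}. \<bar>L j d + q j s * d $ j\<bar> < \<eta> / 2)"
  proof (intro eventually_all_finite eventually_conj eventually_ball_finite ballI)
    fix j
    have "((\<lambda>d. \<bar>d $ j\<bar>) \<longlongrightarrow> \<bar>(0::real^'p) $ j\<bar>) (nhds 0)"
      by (intro tendsto_intros filterlim_ident)
    then show "\<forall>\<^sub>F d in nhds (0::real^'p). \<bar>d $ j\<bar> < \<delta> j"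
      by (rule order_tendstoD(2)) (simp add: \<delta>)
    fix s :: real
    have "linear (L j)" by (rule linearI) (auto simp: L_add L_scale)
    then have "continuous_on UNIV (L j)" by (rule linear_continuous_on[OF linear_conv_bounded_linear[THEN iffD1]])
    then have "(L j \<longlongrightarrow> L j 0) (nhds 0)"
      by (simp add: continuous_on_eq_continuous_at isCont_def tendsto_at_iff_tendsto_nhds)
    then have "((\<lambda>d. \<bar>L j d + q j s * d $ j\<bar>) \<longlongrightarrow> \<bar>L j 0 + q j s * (0::real^'p) $ j\<bar>) (nhds 0)"
      by (intro tendsto_intros filterlim_ident)
    then show "\<forall>\<^sub>F d in nhds 0. \<bar>L j d + q j s * d $ j\<bar> < \<eta> / 2"
      by (rule order_tendstoD(2)) (use \<eta> in \<open>simp add: L_def\<close>)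
  qed auto
  then obtain \<epsilon>0 where \<epsilon>0: "\<epsilon>0 > 0" and small: "\<And>d j. norm d < \<epsilon>0 \<Longrightarrow> \<bar>d $ j\<bar> < \<delta> j"
      "\<And>d j s. norm d < \<epsilon>0 \<Longrightarrow> s \<in> {-1, 1} \<Longrightarrow> \<bar>L j d + q j s * d $ j\<bar> < \<eta> / 2"
    unfolding eventually_nhds_metric dist_norm by auto
  have "penalized_ls X y r x - penalized_ls X y r l \<le> (sqrt K * norm v)\<^sup>2"
    if x: "norm (x - l) < min \<epsilon>0 (\<eta> / 2)" and v: "norm v < min \<epsilon>0 (\<eta> / 2)"
      and grad: "\<And>j D. (r has_real_derivative D) (at (x $ j)) \<Longrightarrow> v $ j = ls_gradient X y x $ j + D"
    for x v
  proof -
    define d where "d = x - l"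
    define \<sigma> where "\<sigma> j = sgn (d $ j)" for j
    have d: "norm d < \<epsilon>0" and xd: "x = l + d" using x by (auto simp: d_def)
    have \<sigma>: "\<sigma> \<in> \<Sigma>" by (auto simp: \<Sigma>_def \<sigma>_def sgn_real_def)
    have mask: "(\<chi> i. \<bar>\<sigma> i\<bar> * d $ i) = d" by (auto simp: vec_eq_iff \<sigma>_def sgn_real_def)
    have dv: "v $ j = L j d + q j (\<sigma> j) * d $ j \<and> g $ j + p j (\<sigma> j) = 0" if "d $ j \<noteq> 0" for j
    proof -
      have s: "\<sigma> j \<in> {-1, 1}" using that by (auto simp: \<sigma>_def sgn_real_def)
      have "(r has_real_derivative p j (sgn (d $ j)) + q j (sgn (d $ j)) * d $ j) (at (l $ j + d $ j))"
        using pq that small(1)[OF d] by (rule locally_quadratic_deriv)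
      then have "v $ j = ls_gradient X y x $ j + (p j (\<sigma> j) + q j (\<sigma> j) * d $ j)"
        by (intro grad) (simp add: xd \<sigma>_def)
      then have v': "v $ j = (g $ j + p j (\<sigma> j)) + (L j d + q j (\<sigma> j) * d $ j)"
        by (simp add: xd ls_gradient_add g_def L_def)
      moreover have "\<bar>v $ j\<bar> < \<eta> / 2" using component_le_norm_cart[of v j] v by simp
      \<comment> \<open>The gradient entry and the second-order part are each below
        \<open>\<eta> / 2\<close>, so by the choice of \<open>\<eta>\<close> the slope is
        zero.\<close>
      ultimately have "\<bar>g $ j + p j (\<sigma> j)\<bar> < \<eta>"
        using small(2)[OF d s, of j] by linarith
      moreover have "g $ j + p j (\<sigma> j) \<in> ?G" using s by force
      ultimately have "g $ j + p j (\<sigma> j) = 0" using \<eta>(2) by (fastforce simp: dist_real_def)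
      with v' show ?thesis by simp
    qed
    \<comment> \<open>Where \<open>d $ j = 0\<close> the penalty may have a kink, and then
      \<open>v $ j\<close> carries no information; the mask removes these entries.\<close>
    have Ad: "A \<sigma> d $ j = \<bar>\<sigma> j\<bar> * v $ j" for j
    proof (cases "d $ j = 0")
      case True
      then show ?thesis by (simp add: A_def \<sigma>_def)
    next
      case False
      then show ?thesis using dv[OF False] by (simp only: A_def vec_lambda_beta mask)
    qed
    have "norm (A \<sigma> d) \<le> norm v"
      by (rule norm_le_componentwise_cart) (auto simp: Ad \<sigma>_def sgn_real_def)
    have "(\<Sum>j\<in>UNIV. r (l $ j + d $ j) - r (l $ j))
        = (\<Sum>j\<in>UNIV. p j (\<sigma> j) * d $ j + q j (\<sigma> j) / 2 * (d $ j)\<^sup>2)"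
    proof (rule sum.cong)
      show "r (l $ j + d $ j) - r (l $ j) = p j (\<sigma> j) * d $ j + q j (\<sigma> j) / 2 * (d $ j)\<^sup>2" for j
        using pq[of "d $ j" j] small(1)[OF d, of j] by (cases "d $ j = 0") (auto simp: \<sigma>_def)
    qed simp
    moreover have "1 / (2 * real CARD('n)) * (norm (X *v d))\<^sup>2 = (\<Sum>j\<in>UNIV. d $ j * L j d / 2)"
      using L_sum[of d d] by (simp add: power2_norm_eq_inner flip: sum_divide_distrib)
    ultimately have "penalized_ls X y r x - penalized_ls X y r l
        = (\<Sum>j\<in>UNIV. g $ j * d $ j + d $ j * L j d / 2
            + (p j (\<sigma> j) * d $ j + q j (\<sigma> j) / 2 * (d $ j)\<^sup>2))"
      by (simp add: xd penalized_ls_add g_def sum.distrib)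
    also have "\<dots> = (\<Sum>j\<in>UNIV. 1 / 2 * (d $ j * A \<sigma> d $ j))"
    proof (rule sum.cong)
      fix j
      show "g $ j * d $ j + d $ j * L j d / 2 + (p j (\<sigma> j) * d $ j + q j (\<sigma> j) / 2 * (d $ j)\<^sup>2)
          = 1 / 2 * (d $ j * A \<sigma> d $ j)"
      proof (cases "d $ j = 0")
        case False
        then have \<sigma>1: "\<bar>\<sigma> j\<bar> = 1" by (simp add: \<sigma>_def)
        have p: "p j (\<sigma> j) = - g $ j" using dv[OF False] by linarith
        show ?thesis
          using dv[OF False] unfolding Ad \<sigma>1 p by (simp add: algebra_simps power2_eq_square)
      qed simp
    qed simp
    also have "\<dots> = 1 / 2 * (d \<bullet> A \<sigma> d)" by (simp add: inner_vec_def sum_distrib_left)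
    also have "\<dots> \<le> 1 / 2 * (K * (norm v)\<^sup>2)"
    proof (rule mult_left_mono)
      have "d \<bullet> A \<sigma> d \<le> C \<sigma> * (norm (A \<sigma> d))\<^sup>2" by (rule C)
      also have "\<dots> \<le> K * (norm (A \<sigma> d))\<^sup>2" using CK[OF \<sigma>] by (intro mult_right_mono) auto
      also have "\<dots> \<le> K * (norm v)\<^sup>2"
        using \<open>K \<ge> 0\<close> \<open>norm (A \<sigma> d) \<le> norm v\<close> by (intro mult_left_mono power_mono) auto
      finally show "d \<bullet> A \<sigma> d \<le> K * (norm v)\<^sup>2" .
    qed simp
    also have "\<dots> \<le> (sqrt K * norm v)\<^sup>2"
      using \<open>K \<ge> 0\<close> by (simp add: power_mult_distrib)
    finally show ?thesis .
  qed
  moreover have "min \<epsilon>0 (\<eta> / 2) > 0" "sqrt K \<ge> 0" using \<epsilon>0 \<eta> \<open>K \<ge> 0\<close> by auto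
  ultimately show ?thesis by blast
qed

section \<open>Cycles of coordinate descent\<close>

definition merge_coords :: "'p set \<Rightarrow> real^'p \<Rightarrow> real^'p \<Rightarrow> real^'p" where
  "merge_coords A c b = (\<chi> i. if i \<in> A then c $ i else b $ i)"

text \<open>Both update rules are cycles of this form, from \<open>b\<close> to \<open>c\<close> in
  the order \<open>\<rho>\<close>; the cyclic rule is \<open>\<rho> = id\<close>.\<close>

definition cd_cycle ::
    "real^'p::{finite,linorder}^'n \<Rightarrow> real^'n \<Rightarrow> (real \<Rightarrow> real)
       \<Rightarrow> ('p::{finite,linorder} \<Rightarrow> 'p::{finite,linorder})
       \<Rightarrow> real^'p::{finite,linorder} \<Rightarrow> real^'p::{finite,linorder} \<Rightarrow> bool" where
  "cd_cycle X y r \<rho> b c \<longleftrightarrow> bij \<rho> \<and> (\<forall>j. is_arg_min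
     (cd_objective X y r b (merge_coords (\<rho> ` {..<j}) c b) (\<rho> j)) (\<lambda>_. True) (c $ \<rho> j))"

lemma cd_cycle_minimal:
  assumes "cd_cycle X y r \<rho> b c"
  shows "cd_objective X y r b (merge_coords (\<rho> ` {..<j}) c b) (\<rho> j) (c $ \<rho> j)
    \<le> cd_objective X y r b (merge_coords (\<rho> ` {..<j}) c b) (\<rho> j) t"
  using assms by (simp add: cd_cycle_def is_arg_min_linorder)

lemma merge_coords_current:
  assumes "cd_cycle X y r \<rho> b c"
  shows "merge_coords (\<rho> ` {..<j}) c b $ \<rho> j = b $ \<rho> j"
  using assms by (auto simp: cd_cycle_def merge_coords_def dest: bij_is_inj injD)

text \<open>The update objective is \<open>r\<close> plus \<open>t\<^sup>2 / 2\<close> plus an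
  affine function. Since \<open>r\<close> is concave by at most \<open>1 - \<mu>\<close>, curvature
  \<open>\<mu>\<close> remains, and quadratic growth at the minimizer applies.\<close>

lemma cd_update_decrease:
  fixes X :: "real^'p^'n"
  assumes std: "standardized X y"
    and conv: "convex_on UNIV (\<lambda>t. r t + (1 - \<mu>) / 2 * t\<^sup>2)"
    and zb: "z $ j = b $ j"
    and min: "\<And>t. cd_objective X y r b z j s \<le> cd_objective X y r b z j t"
  shows "\<mu> / 2 * (s - b $ j)\<^sup>2 \<le> penalized_ls X y r z - penalized_ls X y r (set_coord z j s)"
proof -
  let ?\<phi> = "cd_objective X y r b z j"
  let ?c = "1 / real CARD('n) * (column j X \<bullet> (X *v z - y))"
  have "?\<phi> t - \<mu> / 2 * t\<^sup>2 = (r t + (1 - \<mu>) / 2 * t\<^sup>2) + ((?c - b $ j) * t + (b $ j)\<^sup>2 / 2)" for t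
    by (simp add: cd_objective_def norm_column_standardized[OF std] power2_diff field_simps)
  moreover have "convex_on UNIV (\<lambda>t. (?c - b $ j) * t + (b $ j)\<^sup>2 / 2)"
    by (rule convex_on_of_supports) (auto intro!: exI[of _ "?c - b $ j"] simp: algebra_simps)
  ultimately have "convex_on UNIV (\<lambda>t. ?\<phi> t - \<mu> / 2 * t\<^sup>2)"
    using convex_on_add[OF conv] by simp
  then have "\<mu> / 2 * (b $ j - s)\<^sup>2 \<le> ?\<phi> (b $ j) - ?\<phi> s"
    by (rule minimizer_quadratic_growth) (rule min)
  also have "\<dots> = penalized_ls X y r (set_coord z j (b $ j)) - penalized_ls X y r (set_coord z j s)"
    by (simp add: penalized_ls_set_coord[OF zb])
  also have "set_coord z j (b $ j) = z" using zb by (simp add: set_coord_def vec_eq_iff)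
  finally show ?thesis by (simp add: power2_commute)
qed

lemma cd_cycle_decrease:
  fixes X :: "real^'p::{finite,linorder}^'n"
  assumes std: "standardized X y"
    and conv: "convex_on UNIV (\<lambda>t. r t + (1 - \<mu>) / 2 * t\<^sup>2)"
    and cyc: "cd_cycle X y r \<rho> b c"
  shows "\<mu> / 2 * (norm (c - b))\<^sup>2 \<le> penalized_ls X y r b - penalized_ls X y r c"
proof -
  let ?F = "penalized_ls X y r"
  have bij: "bij \<rho>" using cyc by (simp add: cd_cycle_def)
  \<comment> \<open>The single-update decreases are summed by induction over positions. For a
    downward closed set, removing the maximum \<open>j\<close> leaves \<open>{..<j}\<close>,
    precisely the positions already processed.\<close>
  have "(\<forall>a\<in>A. \<forall>a'<a. a' \<in> A) \<longrightarrow>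
      \<mu> / 2 * (\<Sum>i\<in>\<rho> ` A. (c $ i - b $ i)\<^sup>2) \<le> ?F b - ?F (merge_coords (\<rho> ` A) c b)" for A
    using finite[of A]
  proof (induction A rule: finite_linorder_max_induct)
    case empty
    show ?case by (simp add: merge_coords_def)
  next
    case (insert j A)
    show ?case
    proof
      assume down: "\<forall>a\<in>insert j A. \<forall>a'<a. a' \<in> insert j A"
      have A: "A = {..<j}" using down insert.hyps by auto
      have nin: "\<rho> j \<notin> \<rho> ` A" using bij by (auto simp: A dest: bij_is_inj injD)
      have IH: "\<mu> / 2 * (\<Sum>i\<in>\<rho> ` A. (c $ i - b $ i)\<^sup>2) \<le> ?F b - ?F (merge_coords (\<rho> ` A) c b)"
        using insert.IH by (auto simp: A)
      have "\<mu> / 2 * (c $ \<rho> j - b $ \<rho> j)\<^sup>2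
          \<le> ?F (merge_coords (\<rho> ` A) c b) - ?F (set_coord (merge_coords (\<rho> ` A) c b) (\<rho> j) (c $ \<rho> j))"
        unfolding A
        by (rule cd_update_decrease[OF std conv merge_coords_current[OF cyc] cd_cycle_minimal[OF cyc]])
      also have "set_coord (merge_coords (\<rho> ` A) c b) (\<rho> j) (c $ \<rho> j) = merge_coords (\<rho> ` insert j A) c b"
        by (auto simp: set_coord_def merge_coords_def vec_eq_iff)
      finally show "\<mu> / 2 * (\<Sum>i\<in>\<rho> ` insert j A. (c $ i - b $ i)\<^sup>2)
          \<le> ?F b - ?F (merge_coords (\<rho> ` insert j A) c b)"
        using IH nin by (simp add: distrib_left)
    qed
  qed
  from this[of UNIV] have "\<mu> / 2 * (\<Sum>i\<in>UNIV. (c $ i - b $ i)\<^sup>2) \<le> ?F b - ?F (merge_coords UNIV c b)"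
    using bij by (simp add: bij_is_surj)
  moreover have "merge_coords UNIV c b = c" by (simp add: merge_coords_def vec_eq_iff)
  moreover have "(norm (c - b))\<^sup>2 = (\<Sum>i\<in>UNIV. (c $ i - b $ i)\<^sup>2)"
    unfolding power2_norm_eq_inner by (simp add: inner_vec_def power2_eq_square)
  ultimately show ?thesis by simp
qed

text \<open>Each coordinate is optimal for the vector at the moment of its update. Later updates
  change the gradient by a multiple of the cycle length at most, since the least squares part has a
  linear gradient.\<close>

lemma cd_cycle_gradient:
  fixes X :: "real^'p::{finite,linorder}^'n"
  assumes std: "standardized X y"
  shows "\<exists>B\<ge>0. \<forall>\<rho> b c. cd_cycle X y r \<rho> b c \<longrightarrow> (\<exists>v. norm v \<le> B * norm (c - b) \<and>
    (\<forall>j D. (r has_real_derivative D) (at (c $ j)) \<longrightarrow> v $ j = ls_gradient X y c $ j + D))"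
proof -
  have "linear ((*v) X)" by simp
  from linear_bounded_pos[OF this]
  obtain K where K: "K > 0" "\<And>x. norm (X *v x) \<le> K * norm x" by blast
  define B where "B = (\<Sum>j\<in>UNIV. 1 / real CARD('n) * (norm (column j X) * K) + 1)"
  have "B \<ge> 0" unfolding B_def using K by (intro sum_nonneg add_nonneg_nonneg mult_nonneg_nonneg) auto
  moreover have "\<exists>v. norm v \<le> B * norm (c - b) \<and>
    (\<forall>j D. (r has_real_derivative D) (at (c $ j)) \<longrightarrow> v $ j = ls_gradient X y c $ j + D)"
    if cyc: "cd_cycle X y r \<rho> b c" for \<rho> b c
  proof -
    have bij: "bij \<rho>" using cyc by (simp add: cd_cycle_def)
    define z where "z j = merge_coords (\<rho> ` {..<inv \<rho> j}) c b" for j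
    \<comment> \<open>Obtained by solving the optimality condition at \<open>z j\<close> for the
      gradient entry at \<open>c\<close>. The formula makes sense also where \<open>r\<close> has a
      kink, so the norm bound covers all coordinates.\<close>
    define v where "v = (\<chi> j. 1 / real CARD('n) * (column j X \<bullet> (X *v (c - z j))) - (c $ j - b $ j))"
    have inv: "\<rho> (inv \<rho> j) = j" for j using bij by (simp add: bij_is_surj surj_f_inv_f)
    have "\<bar>v $ j\<bar> \<le> (1 / real CARD('n) * (norm (column j X) * K) + 1) * norm (c - b)" for j
    proof -
      have "\<bar>column j X \<bullet> (X *v (c - z j))\<bar> \<le> norm (column j X) * norm (X *v (c - z j))"
        by (rule Cauchy_Schwarz_ineq2)
      also have "\<dots> \<le> norm (column j X) * (K * norm (c - b))"
      proof (rule mult_left_mono)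
        have "norm (c - z j) \<le> norm (c - b)"
          by (rule norm_le_componentwise_cart) (simp add: z_def merge_coords_def)
        then show "norm (X *v (c - z j)) \<le> K * norm (c - b)"
          using K by (meson mult_left_mono order_trans less_imp_le)
      qed simp
      finally have "\<bar>1 / real CARD('n) * (column j X \<bullet> (X *v (c - z j)))\<bar>
          \<le> 1 / real CARD('n) * (norm (column j X) * K) * norm (c - b)"
        by (simp add: abs_mult divide_right_mono mult.assoc)
      moreover have "\<bar>c $ j - b $ j\<bar> \<le> norm (c - b)"
        using component_le_norm_cart[of "c - b" j] by simp
      ultimately show ?thesis unfolding v_def by (simp only: vec_lambda_beta distrib_right)
    qed
    then have "(\<Sum>j\<in>UNIV. \<bar>v $ j\<bar>) \<le> B * norm (c - b)"
      unfolding B_def sum_distrib_right by (rule sum_mono)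
    then have "norm v \<le> B * norm (c - b)" using norm_le_l1_cart[of v] by linarith
    moreover have "v $ j = ls_gradient X y c $ j + D"
      if D: "(r has_real_derivative D) (at (c $ j))" for j D
    proof -
      let ?\<phi> = "cd_objective X y r b (z j) j"
      let ?g = "1 / real CARD('n) * (column j X \<bullet> (X *v z j - y))"
      have "?\<phi> t = 1 / 2 * (t - b $ j)\<^sup>2 + ?g * t + r t" for t
        by (simp add: cd_objective_def norm_column_standardized[OF std])
      moreover have "((\<lambda>t. 1 / 2 * (t - b $ j)\<^sup>2 + ?g * t + r t) has_real_derivative
          (c $ j - b $ j) + ?g + D) (at (c $ j))"
        by (auto intro!: derivative_eq_intros D)
      ultimately have "(?\<phi> has_real_derivative (c $ j - b $ j) + ?g + D) (at (c $ j))"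
        by presburger
      moreover have "?\<phi> (c $ j) \<le> ?\<phi> t" for t
        using cd_cycle_minimal[OF cyc, of "inv \<rho> j" t] by (simp add: inv z_def)
      ultimately have "(c $ j - b $ j) + ?g + D = 0"
        using DERIV_local_min[of ?\<phi> _ "c $ j" 1] by auto
      moreover have "ls_gradient X y c $ j = ?g + 1 / real CARD('n) * (column j X \<bullet> (X *v (c - z j)))"
        using ls_gradient_add[of X y "z j" "c - z j" j] by (simp add: ls_gradient_def)
      ultimately show ?thesis by (simp add: v_def)
    qed
    ultimately show ?thesis by blast
  qed
  ultimately show ?thesis by blast
qed

section \<open>Convergence of the cycles and optimality of the limit\<close>

lemma isCont_penalized_ls:
  assumes "\<And>t. isCont r t"
  shows "isCont (penalized_ls X y r) (b :: real^'p)"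
proof -
  have "isCont ((*v) X) b" by (intro linear_continuous_at) (simp add: linear_conv_bounded_linear[symmetric])
  moreover have "isCont (\<lambda>b. r (b $ j)) b" for j
    by (rule isCont_o2[OF _ assms]) (intro continuous_intros)
  ultimately show ?thesis unfolding penalized_ls_def by (intro continuous_intros)
qed

text \<open>Both ends of the cycle tend to \<open>l\<close>, hence so does every partially updated
  vector, however the permutations vary with \<open>k\<close>. The inequality between objective
  values then passes to the limit by continuity.\<close>

lemma limit_coordinatewise_minimizer:
  fixes X :: "real^'p::{finite,linorder}^'n"
  assumes cont: "\<And>t. isCont r t"
    and cyc: "\<And>k. cd_cycle X y r (\<rho> k) (b k) (c k)"
    and b: "b \<longlonglongrightarrow> l" and c: "c \<longlonglongrightarrow> l"
  shows "coordinatewise_minimizer (penalized_ls X y r) l"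
proof -
  let ?F = "penalized_ls X y r"
  have "?F (set_coord l j (l $ j)) \<le> ?F (set_coord l j t)" for j t
  proof -
    define z where "z k = merge_coords (\<rho> k ` {..<inv (\<rho> k) j}) (c k) (b k)" for k
    have z: "z \<longlonglongrightarrow> l"
    proof (rule vec_tendstoI)
      fix i
      show "(\<lambda>k. z k $ i) \<longlonglongrightarrow> l $ i"
        unfolding z_def merge_coords_def vec_lambda_beta
        by (rule filterlim_If; rule tendsto_mono[OF inf_le1 tendsto_vec_nth]; rule b c)
    qed
    have lim: "(\<lambda>k. ?F (set_coord (z k) j (f k))) \<longlonglongrightarrow> ?F (set_coord l j f0)" if "f \<longlonglongrightarrow> f0" for f f0
    proof (rule isCont_tendsto_compose[OF isCont_penalized_ls[OF cont]], rule vec_tendstoI)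
      show "(\<lambda>k. set_coord (z k) j (f k) $ i) \<longlonglongrightarrow> set_coord l j f0 $ i" for i
        using that by (auto simp: set_coord_def intro!: tendsto_vec_nth z)
    qed
    have "?F (set_coord (z k) j (c k $ j)) \<le> ?F (set_coord (z k) j t)" for k
    proof -
      have "\<rho> k (inv (\<rho> k) j) = j"
        using cyc[of k] by (simp add: cd_cycle_def bij_is_surj surj_f_inv_f)
      then show ?thesis
        using cd_cycle_minimal[OF cyc, of k "inv (\<rho> k) j" t] merge_coords_current[OF cyc, of k "inv (\<rho> k) j"]
          penalized_ls_set_coord[of "z k" j "b k" X y r "c k $ j" t]
        by (simp add: z_def)
    qed
    then show ?thesis
      using LIMSEQ_le[OF lim[OF tendsto_vec_nth[OF c]] lim[OF tendsto_const]] by blast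
  qed
  then show ?thesis
    by (simp add: coordinatewise_minimizer_def is_arg_min_linorder set_coord_def)
qed

theorem cd_cycles_converge:
  fixes X :: "real^'p::{finite,linorder}^'n" and \<beta> :: "nat \<Rightarrow> real^'p::{finite,linorder}"
  assumes std: "standardized X y"
    and quad: "locally_quadratic r"
    and conv: "convex_on UNIV (\<lambda>t. r t + (1 - \<mu>) / 2 * t\<^sup>2)" and \<mu>: "\<mu> > 0"
    and nonneg: "\<And>t. r t \<ge> 0"
    and cyc: "\<And>k. cd_cycle X y r (\<rho> k) (\<beta> k) (\<beta> (Suc k))"
    and s: "strict_mono s" and lim: "(\<beta> \<circ> s) \<longlonglongrightarrow> l"
  shows "\<beta> \<longlonglongrightarrow> l" and "coordinatewise_minimizer (penalized_ls X y r) l"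
proof -
  let ?F = "penalized_ls X y r"
  \<comment> \<open>Continuity of the penalty comes from convexity on an open set, after which the
    square is subtracted again.\<close>
  have "continuous_on UNIV (\<lambda>t. r t + (1 - \<mu>) / 2 * t\<^sup>2)"
    by (rule convex_on_continuous[OF open_UNIV conv])
  then have "continuous_on UNIV (\<lambda>t. (r t + (1 - \<mu>) / 2 * t\<^sup>2) - (1 - \<mu>) / 2 * t\<^sup>2)"
    by (rule continuous_on_diff) (intro continuous_intros)
  then have cont: "isCont r t" for t by (simp add: continuous_on_eq_continuous_at)
  define e where "e k = ?F (\<beta> k) - ?F l" for k
  have dec: "\<mu> / 2 * (norm (\<beta> (Suc k) - \<beta> k))\<^sup>2 \<le> e k - e (Suc k)" for k
    using cd_cycle_decrease[OF std conv cyc] by (simp add: e_def)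
  have e: "e \<longlonglongrightarrow> 0"
  proof -
    have "decseq e"
    proof (rule decseq_SucI)
      fix k
      have "0 \<le> \<mu> / 2 * (norm (\<beta> (Suc k) - \<beta> k))\<^sup>2" using \<mu> by simp
      then show "e (Suc k) \<le> e k" using dec[of k] by linarith
    qed
    moreover have "- ?F l \<le> e k" for k
      by (simp add: e_def penalized_ls_def sum_nonneg nonneg)
    \<comment> \<open>Monotonicity yields some limit of the whole sequence; the subsequence tending
      to \<open>l\<close> identifies it as 0.\<close>
    ultimately obtain L where L: "e \<longlonglongrightarrow> L" by (metis decseq_convergent)
    have "(\<lambda>m. ?F ((\<beta> \<circ> s) m)) \<longlonglongrightarrow> ?F l"
      by (rule isCont_tendsto_compose[OF isCont_penalized_ls[OF cont] lim])
    then have "(e \<circ> s) \<longlonglongrightarrow> ?F l - ?F l"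
      unfolding e_def o_def by (intro tendsto_intros)
    with LIMSEQ_subseq_LIMSEQ[OF L s] have "L = 0" using LIMSEQ_unique by fastforce
    with L show ?thesis by simp
  qed
  \<comment> \<open>Vanishing steps make the gradients small, as the local error bound requires in
    addition to closeness to \<open>l\<close>.\<close>
  have step0: "(\<lambda>k. norm (\<beta> (Suc k) - \<beta> k)) \<longlonglongrightarrow> 0"
  proof -
    have up: "(\<lambda>k. 2 / \<mu> * (e k - e (Suc k))) \<longlonglongrightarrow> 2 / \<mu> * (0 - 0)"
      by (intro tendsto_intros e LIMSEQ_Suc[OF e])
    have le: "(norm (\<beta> (Suc k) - \<beta> k))\<^sup>2 \<le> 2 / \<mu> * (e k - e (Suc k))" for k
      using dec[of k] \<mu> by (simp add: field_simps)
    have "(\<lambda>k. (norm (\<beta> (Suc k) - \<beta> k))\<^sup>2) \<longlonglongrightarrow> 0"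
    proof (rule tendsto_sandwich[OF _ _ tendsto_const])
      show "(\<lambda>k. 2 / \<mu> * (e k - e (Suc k))) \<longlonglongrightarrow> 0" using up by simp
    qed (use le in \<open>auto intro!: always_eventually simp del: right_diff_distrib_numeral\<close>)
    from tendsto_real_sqrt[OF this] show ?thesis by simp
  qed
  define is_grad where "is_grad x v \<longleftrightarrow>
    (\<forall>j D. (r has_real_derivative D) (at (x $ j)) \<longrightarrow> v $ j = ls_gradient X y x $ j + D)" for x v
  obtain \<epsilon> \<kappa> where \<epsilon>: "\<epsilon> > 0" and \<kappa>: "\<kappa> \<ge> 0"
    and bound: "\<forall>x v. norm (x - l) < \<epsilon> \<longrightarrow> norm v < \<epsilon> \<longrightarrow> is_grad x v \<longrightarrow>
      ?F x - ?F l \<le> (\<kappa> * norm v)\<^sup>2"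
    using penalized_ls_error_bound[OF quad, of l X y] unfolding is_grad_def[symmetric] by blast
  obtain B where B: "B \<ge> 0"
    and B': "\<forall>\<rho> b c. cd_cycle X y r \<rho> b c \<longrightarrow> (\<exists>v. norm v \<le> B * norm (c - b) \<and> is_grad c v)"
    using cd_cycle_gradient[OF std, of r] unfolding is_grad_def[symmetric] by blast
  have "\<forall>k. \<exists>v. norm v \<le> B * norm (\<beta> (Suc k) - \<beta> k) \<and> is_grad (\<beta> (Suc k)) v"
    using B' cyc by blast
  from choice[OF this] obtain v where v: "\<And>k. norm (v k) \<le> B * norm (\<beta> (Suc k) - \<beta> k)"
    and grad: "\<And>k. is_grad (\<beta> (Suc k)) (v k)"
    by blast
  have "(\<lambda>k. B * norm (\<beta> (Suc k) - \<beta> k)) \<longlonglongrightarrow> 0"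
    using tendsto_mult_right_zero[OF step0] .
  then have "\<forall>\<^sub>F k in sequentially. B * norm (\<beta> (Suc k) - \<beta> k) < \<epsilon>"
    using \<epsilon> by (rule order_tendstoD(2))
  then have "\<forall>\<^sub>F k in sequentially. norm (\<beta> (Suc k) - l) < \<epsilon> \<longrightarrow>
      e (Suc k) \<le> (\<kappa> * B * norm (\<beta> (Suc k) - \<beta> k))\<^sup>2"
  proof eventually_elim
    case (elim k)
    show ?case
    proof
      assume "norm (\<beta> (Suc k) - l) < \<epsilon>"
      then have "e (Suc k) \<le> (\<kappa> * norm (v k))\<^sup>2"
        unfolding e_def using elim v[of k] grad[of k] bound by fastforce
      also have "\<dots> \<le> (\<kappa> * (B * norm (\<beta> (Suc k) - \<beta> k)))\<^sup>2"
        using \<kappa> v by (intro power_mono mult_left_mono) auto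
      finally show "e (Suc k) \<le> (\<kappa> * B * norm (\<beta> (Suc k) - \<beta> k))\<^sup>2" by (simp add: mult.assoc)
    qed
  qed
  note ev = this
  show \<beta>: "\<beta> \<longlonglongrightarrow> l"
  proof (rule descent_sequence_converges[OF _ _ \<epsilon> dec e ev s lim])
    show "0 < \<mu> / 2" "0 \<le> \<kappa> * B" using \<mu> \<kappa> B by simp_all
  qed
  show "coordinatewise_minimizer ?F l"
    by (rule limit_coordinatewise_minimizer[OF cont cyc \<beta> LIMSEQ_Suc[OF \<beta>]])
qed

theorem theorem3p1:
  fixes X :: "real^'p::{finite,linorder}^'n" and y :: "real^'n"
    and lam \<gamma> :: real and r :: "real \<Rightarrow> real" and \<beta> :: "nat \<Rightarrow> real^'p::{finite,linorder}"
  assumes "standardized X y"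
    and "lam \<ge> 0"
    and "(\<gamma> > 1 \<and> r = mcp lam \<gamma>) \<or> (\<gamma> > 2 \<and> r = scad lam \<gamma>)"
    and "cyclic_updates X y r \<beta> \<or> (\<exists>\<pi>. (\<forall>k. bij (\<pi> k)) \<and> shuffled_updates X y r \<pi> \<beta>)"
    and "\<exists>l s. strict_mono s \<and> (\<beta> \<circ> s) \<longlonglongrightarrow> l"
  shows "\<exists>b. \<beta> \<longlonglongrightarrow> b \<and> coordinatewise_minimizer (penalized_ls X y r) b"
proof -
  have "\<exists>\<rho>. \<forall>k. cd_cycle X y r (\<rho> k) (\<beta> k) (\<beta> (Suc k))"
    using assms(4)
  proof (elim disjE exE conjE)
    assume "cyclic_updates X y r \<beta>"
    then have "\<forall>k. cd_cycle X y r id (\<beta> k) (\<beta> (Suc k))"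
      by (simp add: cyclic_updates_def cd_cycle_def merge_coords_def)
    then show ?thesis by (intro exI[of _ "\<lambda>_. id"])
  next
    fix \<pi> assume "\<forall>k. bij (\<pi> k)" "shuffled_updates X y r \<pi> \<beta>"
    then have "\<forall>k. cd_cycle X y r (\<pi> k) (\<beta> k) (\<beta> (Suc k))"
      by (simp add: shuffled_updates_def cd_cycle_def merge_coords_def)
    then show ?thesis by blast
  qed
  then obtain \<rho> where cyc: "\<And>k. cd_cycle X y r (\<rho> k) (\<beta> k) (\<beta> (Suc k))" by blast
  \<comment> \<open>The curvature left over is \<open>1 - 1 / \<gamma>\<close> for MCP and
    \<open>1 - 1 / (\<gamma> - 1)\<close> for SCAD, positive for \<open>\<gamma> > 1\<close> and
    \<open>\<gamma> > 2\<close> respectively.\<close>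
  have "\<exists>\<mu>>0. convex_on UNIV (\<lambda>t. r t + (1 - \<mu>) / 2 * t\<^sup>2)"
    using assms(3)
  proof
    assume "\<gamma> > 1 \<and> r = mcp lam \<gamma>"
    then show ?thesis using mcp_convex[OF assms(2), of \<gamma>] by (intro exI[of _ "1 - 1 / \<gamma>"]) auto
  next
    assume "\<gamma> > 2 \<and> r = scad lam \<gamma>"
    then show ?thesis using scad_convex[OF assms(2), of \<gamma>] by (intro exI[of _ "1 - 1 / (\<gamma> - 1)"]) auto
  qed
  then obtain \<mu> where \<mu>: "\<mu> > 0" "convex_on UNIV (\<lambda>t. r t + (1 - \<mu>) / 2 * t\<^sup>2)" by blast
  have quad: "locally_quadratic r" and nonneg: "\<And>t. r t \<ge> 0"
    using assms(2,3) by (auto intro: mcp_locally_quadratic scad_locally_quadratic mcp_nonneg scad_nonneg)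
  obtain l s where "strict_mono s" "(\<beta> \<circ> s) \<longlonglongrightarrow> l" using assms(5) by blast
  note cd_cycles_converge[OF assms(1) quad \<mu>(2,1) nonneg cyc this]
  then show ?thesis by blast
qed

end
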